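(* For all integers $k, N$ with $2\le k<N$, $$F_k(N)\le \binom{N-1}{k-1}+N-k.$$
   Context: For a positive integer $N$ let $[N]=\{1,2,\dots,N\}$, and let $\binom{[N]}{k}$ denote the family of all $k$-element subsets of $[N]$. For sets of integers $A,B$, the sumset is $A+B=\{a+b: a\in A, b\in B\}$. A family $\mathcal A=\{A_i: i\in I\}$ of (distinct) subsets of $\mathbb Z$ is a Sidon system if $A_i+A_j=A_{i'}+A_{j'}$ implies $\{i,j\}=\{i',j'\}$ for all $i,j,i',j'\in I$. For integers $N>k\ge 1$, $F_k(N)$ denotes the largest cardinality of a Sidon system $\mathcal A\subseteq\binom{[N]}{k}$. *)

theory Defs
  imports Complex_Main "HOL-Library.Set_Algebras"
begin

text \<open>
  Sumsets are written with the addition on sets from \<open>Set_Algebras\<close>: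
  \<open>A + B = {a + b | a \<in> A, b \<in> B}\<close>.  The members of a Sidon system are pairwise distinct,
  so the system is represented by the set of its members, and equality of index
  pairs \<open>{i, j} = {i', j'}\<close> becomes equality of the (unordered) pairs of members.
  The cases \<open>A = B\<close> and \<open>C = D\<close> are included.
\<close>

definition sidon_system :: "int set set \<Rightarrow> bool" where
  "sidon_system \<A> \<longleftrightarrow>
     (\<forall>A\<in>\<A>. \<forall>B\<in>\<A>. \<forall>C\<in>\<A>. \<forall>D\<in>\<A>. A + B = C + D \<longrightarrow> {A, B} = {C, D})"

definition k_subsets :: "nat \<Rightarrow> nat \<Rightarrow> int set set" where
  "k_subsets k N = {A. A \<subseteq> {1..int N} \<and> card A = k}"

definition sidon_number :: "nat \<Rightarrow> nat \<Rightarrow> nat" where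
  "sidon_number k N = Max {card \<A> | \<A>. \<A> \<subseteq> k_subsets k N \<and> sidon_system \<A>}"

text \<open>The maximum is taken over a finite nonempty set, so it is attained.\<close>

lemma finite_k_subsets: "finite (k_subsets k N)"
  unfolding k_subsets_def by (rule finite_subset[of _ "Pow {1..int N}"]) auto

lemma sidon_number_attained:
  "\<exists>\<A>. \<A> \<subseteq> k_subsets k N \<and> sidon_system \<A> \<and> card \<A> = sidon_number k N"
  and card_le_sidon_number:
  "\<A> \<subseteq> k_subsets k N \<Longrightarrow> sidon_system \<A> \<Longrightarrow> card \<A> \<le> sidon_number k N"
proof -
  let ?S = "{card \<A> | \<A>. \<A> \<subseteq> k_subsets k N \<and> sidon_system \<A>}"
  have "?S \<subseteq> card ` Pow (k_subsets k N)"
    by auto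
  then have fin: "finite ?S"
    by (rule finite_subset) (simp add: finite_k_subsets)
  have "card ({} :: int set set) \<in> ?S"
    unfolding sidon_system_def by blast
  then have "Max ?S \<in> ?S"
    using fin by (intro Max_in) auto
  then show "\<exists>\<A>. \<A> \<subseteq> k_subsets k N \<and> sidon_system \<A> \<and> card \<A> = sidon_number k N"
    unfolding sidon_number_def by auto
  show "card \<A> \<le> sidon_number k N" if "\<A> \<subseteq> k_subsets k N" "sidon_system \<A>"
    unfolding sidon_number_def using fin that by (intro Max_ge) auto
qed

end

theory Submission
  imports Defs
begin

text \<open>
  Every set is a translate of a set with minimum \<open>0\<close>, and there are \<open>N - 1 choose (k - 1)\<close> such
  shapes.  If \<open>A\<close>, \<open>d + A\<close>, \<open>B\<close> and \<open>d + B\<close> all belong to a Sidon system and \<open>d \<noteq> 0\<close>,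
  then \<open>A + (d + B) = (d + A) + B\<close> forces \<open>A = B\<close>.  So the distances by which the members
  exceed the leftmost member of the same shape are distinct, and they lie in \<open>{1..N - k}\<close>.
\<close>

definition shape :: "int set \<Rightarrow> int set" where
  "shape A = (- Min A) +o A"

lemma shape_translate: "A = (Min A - Min B) +o B" if "shape A = shape B"
proof -
  have "Min A +o shape A = Min A +o shape B"
    using that by simp
  then show ?thesis
    by (simp add: shape_def set_plus_rearrange2)
qed

text \<open>Of the two ways to match the equal pairs of summands, one would give
  \<open>A = d +o A\<close>. This is excluded directly rather than through
  \<open>d \<noteq> 0\<close>, since a nonzero shift can fix an empty or periodic set.\<close>

lemma sidon_translates_eq:
  assumes "sidon_system \<A>" "A \<in> \<A>" "B \<in> \<A>" "d +o A \<in> \<A>" "d +o B \<in> \<A>" "d +o A \<noteq> A"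
  shows "A = B"
proof -
  have "A + (d +o B) = (d +o A) + B"
    by (simp add: set_plus_rearrange3 set_plus_rearrange4)
  then have "{A, d +o B} = {d +o A, B}"
    using assms unfolding sidon_system_def by blast
  then show ?thesis
    using \<open>d +o A \<noteq> A\<close> by (metis doubleton_eq_iff)
qed

lemma k_subsets_Min_bounds:
  assumes "A \<in> k_subsets k N" "1 \<le> k"
  shows "1 \<le> Min A" "Min A + int k \<le> int N + 1"
proof -
  have fin: "finite A" and ne: "A \<noteq> {}" and sub: "A \<subseteq> {1..int N}" and card: "card A = k"
    using assms by (auto simp: k_subsets_def intro: finite_subset)
  have "Min A \<in> A"
    using fin ne by simp
  then show "1 \<le> Min A"
    using sub by auto
  \<comment> \<open>All \<open>k\<close> elements must fit among the \<open>N + 1 - Min A\<close>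
    integers from \<open>Min A\<close> to \<open>N\<close>.\<close>
  have "A \<subseteq> {Min A..int N}"
    using fin sub by auto
  then have "k \<le> card {Min A..int N}"
    using card card_mono by blast
  then show "Min A + int k \<le> int N + 1"
    using \<open>1 \<le> k\<close> by simp
qed

text \<open>A shape contains \<open>0\<close>, and its other \<open>k - 1\<close> elements are
  differences of elements of \<open>{1..N}\<close>, hence lie in \<open>{1..N - 1}\<close>; they
  determine the shape.\<close>

lemma card_shapes_le:
  assumes "1 \<le> k"
  shows "card (shape ` k_subsets k N) \<le> (N - 1) choose (k - 1)"
proof -
  let ?T = "{B. B \<subseteq> {1..int N - 1} \<and> card B = k - 1}"
  have "shape A \<in> insert 0 ` ?T" if A: "A \<in> k_subsets k N" for A
  proof -
    have fin: "finite A" and ne: "A \<noteq> {}" and sub: "A \<subseteq> {1..int N}" and card: "card A = k"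
      using assms A by (auto simp: k_subsets_def intro: finite_subset)
    have eq: "shape A = (\<lambda>x. x - Min A) ` A"
      by (auto simp: shape_def elt_set_plus_def)
    have zero: "0 \<in> shape A"
      using fin ne Min_in[of A] by (force simp: eq)
    have "card (shape A) = k"
      unfolding eq using card by (subst card_image) (auto simp: inj_on_def)
    then have "card (shape A - {0}) = k - 1"
      using zero by simp
    moreover have "x - Min A \<in> {0..int N - 1}" if "x \<in> A" for x
      using that fin sub Min_le[of A x] k_subsets_Min_bounds[OF A assms] by auto
    then have "shape A - {0} \<subseteq> {1..int N - 1}"
      by (fastforce simp: eq)
    ultimately have "shape A - {0} \<in> ?T"
      by simp
    moreover have "shape A = insert 0 (shape A - {0})"
      using zero by auto
    ultimately show ?thesis
      by blast
  qed
  moreover have fin: "finite ?T"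
    by (rule finite_subset[of _ "Pow {1..int N - 1}"]) auto
  ultimately have "card (shape ` k_subsets k N) \<le> card (insert 0 ` ?T)"
    by (intro card_mono) auto
  also have "\<dots> \<le> card ?T"
    using fin by (rule card_image_le)
  \<comment> \<open>For \<open>N = 0\<close> the interval is empty and the natural number
    \<open>N - 1\<close> is \<open>0\<close> too.\<close>
  also have "\<dots> = (N - 1) choose (k - 1)"
    by (subst n_subsets) (simp_all add: nat_diff_distrib')
  finally show ?thesis .
qed

lemma sidon_system_card_le:
  assumes sidon: "sidon_system \<A>" and sub: "\<A> \<subseteq> k_subsets k N" and k: "1 \<le> k"
  shows "card \<A> \<le> ((N - 1) choose (k - 1)) + (N - k)"
proof -
  have fin: "finite \<A>"
    using sub finite_k_subsets finite_subset by blast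
  define r where "r A = arg_min_on Min {B \<in> \<A>. shape B = shape A}" for A
  have r: "r A \<in> \<A>" "shape (r A) = shape A" "Min (r A) \<le> Min A" if "A \<in> \<A>" for A
  proof -
    have fin': "finite {B \<in> \<A>. shape B = shape A}"
      using fin by simp
    have A: "A \<in> {B \<in> \<A>. shape B = shape A}"
      using that by simp
    then have "r A \<in> {B \<in> \<A>. shape B = shape A}"
      unfolding r_def using fin' arg_min_if_finite(1) by (metis (no_types, lifting) empty_iff)
    then show "r A \<in> \<A>" "shape (r A) = shape A"
      by simp_all
    show "Min (r A) \<le> Min A"
      unfolding r_def using fin' A by (intro arg_min_least) auto
  qed
  define d where "d A = Min A - Min (r A)" for A
  have translate: "d A +o r A = A" if "A \<in> \<A>" for A
    using shape_translate[of A "r A"] r(2)[OF that] by (simp add: d_def)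
  \<comment> \<open>The leftmost members are counted by their shapes, all others by their distance
    \<open>d\<close> from the leftmost one.\<close>
  define M where "M = {A \<in> \<A>. r A = A}"
  \<comment> \<open>The choice of \<open>r A\<close> depends on \<open>A\<close> only through
    \<open>shape A\<close>, and members of \<open>M\<close> are their own \<open>r\<close>.\<close>
  have "inj_on shape M"
    by (rule inj_onI) (auto simp: M_def r_def)
  then have "card M = card (shape ` M)"
    by (simp add: card_image)
  also have "\<dots> \<le> card (shape ` k_subsets k N)"
    using sub by (intro card_mono) (auto simp: finite_k_subsets M_def)
  also have "\<dots> \<le> (N - 1) choose (k - 1)"
    using k by (rule card_shapes_le)
  finally have M: "card M \<le> (N - 1) choose (k - 1)" .
  have "inj_on d (\<A> - M)"
  proof (rule inj_onI)
    fix A B assume A: "A \<in> \<A> - M" and B: "B \<in> \<A> - M" and eq: "d A = d B"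
    have tA: "d A +o r A = A" and tB: "d A +o r B = B"
      using translate[of A] translate[of B] A B eq by simp_all
    have "r A \<noteq> A"
      using A by (simp add: M_def)
    \<comment> \<open>The common shift \<open>d A\<close> carries \<open>r A\<close> to
      \<open>A\<close> and \<open>r B\<close> to \<open>B\<close>, so all four sets are members, and
      \<open>r A \<noteq> A\<close> says that it moves \<open>r A\<close>.\<close>
    then have "r A = r B"
      using A B by (intro sidon_translates_eq[OF sidon, of _ _ "d A"]) (simp_all add: r tA tB)
    then show "A = B"
      using tA tB by metis
  qed
  moreover have "d A \<in> {1..int N - int k}" if "A \<in> \<A> - M" for A
  proof -
    have A: "A \<in> \<A>" "r A \<noteq> A"
      using that by (auto simp: M_def)
    then have "d A \<noteq> 0"
      using translate[of A] by (metis set_zero_plus)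
    moreover have "0 \<le> d A"
      using r(3)[OF A(1)] by (simp add: d_def)
    moreover have "d A \<le> int N - int k"
    proof -
      have "A \<in> k_subsets k N" "r A \<in> k_subsets k N"
        using sub A(1) r(1)[OF A(1)] by blast+
      \<comment> \<open>The minimum of a member is at least \<open>1\<close> and at most
        \<open>N + 1 - k\<close>.\<close>
      then show ?thesis
        using k_subsets_Min_bounds(1)[of "r A" k N] k_subsets_Min_bounds(2)[of A k N] k
        by (simp add: d_def)
    qed
    ultimately show ?thesis
      by simp
  qed
  ultimately have "card (\<A> - M) \<le> card {1..int N - int k}"
    by (intro card_inj_on_le[of d]) auto
  \<comment> \<open>For \<open>k > N\<close> the interval is empty and \<open>N - k\<close>
    truncates to \<open>0\<close>.\<close>
  then have "card (\<A> - M) \<le> N - k"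
    by simp
  moreover have "card \<A> = card M + card (\<A> - M)"
  proof -
    have "M \<subseteq> \<A>"
      by (auto simp: M_def)
    then show ?thesis
      using fin card_mono[of \<A> M] by (simp add: card_Diff_subset finite_subset)
  qed
  ultimately show ?thesis
    using M by simp
qed

theorem theorem1p3:
  fixes k N :: nat
  assumes "2 \<le> k" and "k < N"
  shows "sidon_number k N \<le> ((N - 1) choose (k - 1)) + (N - k)"
  using sidon_number_attained[of k N] sidon_system_card_le[of _ k N] assms by force

end
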